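(* For real $\alpha,\psi,c$ and $\gamma\in(0,\pi/2)$ let $$T=\begin{pmatrix}\cos\gamma & \sin^2\gamma\; e^{i\psi}\\ 0&\cos\gamma\; e^{ic\gamma^2}\end{pmatrix},\qquad \tilde\varrho=\begin{pmatrix}\cos^2\alpha&\cos\alpha\sin\alpha\\ \cos\alpha\sin\alpha&\sin^2\alpha\end{pmatrix},$$ and let $X_1,X_2$ be the $2\times2$ matrices determined by $$X_1-TX_1T^\dagger=\tilde\varrho,\qquad X_2-TX_2T^\dagger=X_1 .$$ Put $\mu=\operatorname{tr}(X_1)$ and $\mathrm{CF}_2=4\operatorname{tr}(X_2)-3\mu^2$. Define $$N_1(\alpha,\psi,c)=1+\frac{2\sin^2\alpha}{1+c^2}+\frac{\cos\psi-c\sin\psi}{1+c^2}\sin(2\alpha),$$ $$N_2(\alpha,\psi,c)=1+\frac{2(3+c^2)}{(1+c^2)^2}\sin^2\alpha+\frac{2\cos\psi-c(3+c^2)\sin\psi}{(1+c^2)^2}\sin(2\alpha).$$ Then: (i) to leading order as $\gamma\to0^+$, with $(\alpha,\psi,c)$ fixed, $$\operatorname{tr}(X_1)\approx\frac{N_1(\alpha,\psi,c)}{\gamma^2},\qquad \operatorname{tr}(X_2)\approx\frac{N_2(\alpha,\psi,c)}{\gamma^4},$$ so that $\mu\to\infty$ and $$\lim_{\mu\to\infty}\frac{\mathrm{CF}_2}{\mu^2}=\frac{4N_2(\alpha,\psi,c)}{N_1(\alpha,\psi,c)^2}-3 ;$$ (ii) minimizing the ratio $\dfrac{4N_2(\alpha,\psi,c)}{N_1(\alpha,\psi,c)^2}-3$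 over $(\alpha,\psi,c)$ yields a global minimum (global asymptotic bound) of exactly $-0.5982$, and this minimum is attained at $\alpha\approx55.67^\circ$, $\psi\approx23.87^\circ$, $c\approx-1.0359$.
   Context: Here $T^\dagger$ is the conjugate transpose of $T$. The matrix $T$ is (in Schur form) the single Kraus operator of the no-tick operation $\varrho\mapsto T\varrho T^\dagger$ of a two-dimensional quantum counting process with pure initial state $\tilde\varrho$; the two loss angles of the general parametrization are taken equal to $\gamma$, and the relative coherent phase of the two diagonal entries is taken to scale as $c\gamma^2$. Since $T$ has spectral radius $\cos\gamma<1$ for $\gamma\in(0,\pi/2)$, the two linear equations for $X_1$ and $X_2$ have unique solutions. The first tick occurs at step $L\ge1$ with probability $p_L=\operatorname{tr}[T^{L-1}\tilde\varrho\,(T^\dagger)^{L-1}]-\operatorname{tr}[T^{L}\tilde\varrho\,(T^\dagger)^{L}]$; $\mu$ is the mean of this distribution, and $\mathrm{CF}_2=2\sigma^2-\mu(\mu-2)$ where $\sigma^2$ is its variance. Every classical two-state counting process satisfies $\mathrm{CF}_2\ge0$, so a negative value is a quantum advantage.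
   Formalization: In (ii) the global minimum is not exactly −0.5982 (it is about −0.598197); what is proved is that the attained global minimum lies within 0.00005 of −0.5982, with α, ψ, c likewise matching their printed values to half a unit in the last digit. *)

theory Defs
  imports "HOL-Analysis.Analysis" "HOL-Library.Landau_Symbols"
begin

definition conj_transpose :: "complex^'n^'m \<Rightarrow> complex^'m^'n" where
  "conj_transpose A = (\<chi> i j. cnj (A $ j $ i))"

definition no_tick :: "real \<Rightarrow> real \<Rightarrow> real \<Rightarrow> complex^2^2" where
  "no_tick \<psi> c \<gamma> = vector
     [vector [of_real (cos \<gamma>), of_real ((sin \<gamma>)\<^sup>2) * cis \<psi>],
      vector [0,                of_real (cos \<gamma>) * cis (c * \<gamma>\<^sup>2)]]"

definition init_state :: "real \<Rightarrow> complex^2^2" where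
  "init_state \<alpha> = vector
     [vector [of_real ((cos \<alpha>)\<^sup>2),      of_real (cos \<alpha> * sin \<alpha>)],
      vector [of_real (cos \<alpha> * sin \<alpha>), of_real ((sin \<alpha>)\<^sup>2)]]"

definition solves_stein :: "complex^2^2 \<Rightarrow> complex^2^2 \<Rightarrow> complex^2^2 \<Rightarrow> bool" where
  "solves_stein T R X \<longleftrightarrow> X - T ** X ** conj_transpose T = R"

text \<open>The definite descriptions below are meaningful for \<open>0 < \<gamma> < \<pi>/2\<close>, where
  the spectral radius \<open>cos \<gamma>\<close> of the no-tick matrix is less than 1.\<close>

definition X1 :: "real \<Rightarrow> real \<Rightarrow> real \<Rightarrow> real \<Rightarrow> complex^2^2" where
  "X1 \<alpha> \<psi> c \<gamma> = (THE X. solves_stein (no_tick \<psi> c \<gamma>) (init_state \<alpha>) X)"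

definition X2 :: "real \<Rightarrow> real \<Rightarrow> real \<Rightarrow> real \<Rightarrow> complex^2^2" where
  "X2 \<alpha> \<psi> c \<gamma> = (THE X. solves_stein (no_tick \<psi> c \<gamma>) (X1 \<alpha> \<psi> c \<gamma>) X)"

text \<open>The traces of \<open>X1\<close> and \<open>X2\<close> are real, so taking real parts only changes the type.
  They are \<open>\<mu> = E[L]\<close> and \<open>E[L(L+1)/2]\<close> for the step \<open>L\<close> of the first tick; hence \<open>CF2\<close> below is
  \<open>2\<sigma>\<^sup>2 - \<mu>(\<mu> - 2)\<close>, with \<open>\<sigma>\<^sup>2\<close> the variance of \<open>L\<close>.\<close>

definition tick_mean :: "real \<Rightarrow> real \<Rightarrow> real \<Rightarrow> real \<Rightarrow> real" where
  "tick_mean \<alpha> \<psi> c \<gamma> = Re (trace (X1 \<alpha> \<psi> c \<gamma>))"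

definition CF2 :: "real \<Rightarrow> real \<Rightarrow> real \<Rightarrow> real \<Rightarrow> real" where
  "CF2 \<alpha> \<psi> c \<gamma> = 4 * Re (trace (X2 \<alpha> \<psi> c \<gamma>)) - 3 * (tick_mean \<alpha> \<psi> c \<gamma>)\<^sup>2"

definition N1 :: "real \<Rightarrow> real \<Rightarrow> real \<Rightarrow> real" where
  "N1 \<alpha> \<psi> c = 1 + 2 * (sin \<alpha>)\<^sup>2 / (1 + c\<^sup>2)
      + (cos \<psi> - c * sin \<psi>) / (1 + c\<^sup>2) * sin (2 * \<alpha>)"

definition N2 :: "real \<Rightarrow> real \<Rightarrow> real \<Rightarrow> real" where
  "N2 \<alpha> \<psi> c = 1 + 2 * (3 + c\<^sup>2) / (1 + c\<^sup>2)\<^sup>2 * (sin \<alpha>)\<^sup>2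
      + (2 * cos \<psi> - c * (3 + c\<^sup>2) * sin \<psi>) / (1 + c\<^sup>2)\<^sup>2 * sin (2 * \<alpha>)"

definition asymp_ratio :: "real \<Rightarrow> real \<Rightarrow> real \<Rightarrow> real" where
  "asymp_ratio \<alpha> \<psi> c = 4 * N2 \<alpha> \<psi> c / (N1 \<alpha> \<psi> c)\<^sup>2 - 3"

end

(*
  Idea.  T is triangular, so the two Stein equations are solved by back substitution.  With
  b / gamma^2 -> e^(i psi) and (1 - a * cnj d) / gamma^2 -> 1 + i c, each solution step multiplies the
  order by gamma^(-2), and the traces of the limits are N1 and N2.

  For the minimum put q = 1 + c^2.  For fixed c, N1 and N2 are affine functions of the Bloch vector
  of the state, and N1^2 / N2 = max_l (2 l N1 - l^2 N2).  For fixed l = 2 q / (q + 2 + x) the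
  maximum over the Bloch sphere is given by Cauchy-Schwarz.  Hence the minimum of 4 N2 / N1^2 is
  1 / max H, where
    H(q,x) = ((q + 1) x + 2 q + sqrt ((q + x)^2 + q x^2)) / (q + 2 + x)^2.
  Writing H <= h as sqrt (..) <= K for a quadratic polynomial K > 0 and squaring, one is left with
  the nonnegativity of a bivariate quartic, up to a tiny error, certified by squares.  The
  certificate has a quadratic margin around the approximate maximizer, which locates the true one.
*)
theory Submission
  imports Defs
begin

section \<open>Stein equations with a triangular matrix\<close>

lemma matrix_2_eq_iff:
  fixes A B :: "'a^2^2"
  shows "A = B \<longleftrightarrow> A$1$1 = B$1$1 \<and> A$1$2 = B$1$2 \<and> A$2$1 = B$2$1 \<and> A$2$2 = B$2$2"
  by (auto simp: vec_eq_iff forall_2)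

definition upper_triangular_2 :: "complex \<Rightarrow> complex \<Rightarrow> complex \<Rightarrow> complex^2^2" where
  "upper_triangular_2 a b d = vector [vector [a, b], vector [0, d]]"

text \<open>Back substitution: the (2,2) equation contains only \<open>X$2$2\<close>, each
  off-diagonal equation contains its own entry and \<open>X$2$2\<close>, and the (1,1) equation
  comes last.\<close>

lemma solves_stein_upper_triangular_iff:
  fixes a b d :: complex
  assumes "a * cnj a \<noteq> 1" "a * cnj d \<noteq> 1" "d * cnj d \<noteq> 1"
  shows "solves_stein (upper_triangular_2 a b d) R X \<longleftrightarrow>
    X$2$2 = R$2$2 / (1 - d * cnj d) \<and>
    X$1$2 = (R$1$2 + b * cnj d * X$2$2) / (1 - a * cnj d) \<and>
    X$2$1 = (R$2$1 + cnj b * d * X$2$2) / (1 - cnj a * d) \<and>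
    X$1$1 = (R$1$1 + a * cnj b * X$1$2 + cnj a * b * X$2$1 + b * cnj b * X$2$2) / (1 - a * cnj a)"
proof -
  \<comment> \<open>The fourth denominator, \<open>1 - cnj a * d\<close>, is the conjugate of the
    second.\<close>
  have "cnj (a * cnj d) \<noteq> cnj 1"
    using assms(2) by (metis complex_cnj_cancel_iff)
  with assms have nz: "1 - a * cnj a \<noteq> 0" "1 - a * cnj d \<noteq> 0" "1 - d * cnj d \<noteq> 0" "1 - cnj a * d \<noteq> 0"
    by simp_all
  show ?thesis
    unfolding solves_stein_def matrix_2_eq_iff upper_triangular_2_def nz[THEN nonzero_eq_divide_eq]
    by (auto simp: matrix_matrix_mult_def conj_transpose_def sum_2 vector_2 algebra_simps)
qed

lemma ex1_solves_stein_upper_triangular: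
  fixes a b d :: complex
  assumes "a * cnj a \<noteq> 1" "a * cnj d \<noteq> 1" "d * cnj d \<noteq> 1"
  shows "\<exists>!X. solves_stein (upper_triangular_2 a b d) R X"
proof -
  define w where "w = R$2$2 / (1 - d * cnj d)"
  define y where "y = (R$1$2 + b * cnj d * w) / (1 - a * cnj d)"
  define z where "z = (R$2$1 + cnj b * d * w) / (1 - cnj a * d)"
  define x where "x = (R$1$1 + a * cnj b * y + cnj a * b * z + b * cnj b * w) / (1 - a * cnj a)"
  show ?thesis
  proof (rule ex1I)
    show "solves_stein (upper_triangular_2 a b d) R (vector [vector [x, y], vector [z, w]])"
      unfolding solves_stein_upper_triangular_iff[OF assms] by (simp add: vector_2 w_def y_def z_def x_def)
    show "X = vector [vector [x, y], vector [z, w]]" if "solves_stein (upper_triangular_2 a b d) R X" for X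
      using that unfolding solves_stein_upper_triangular_iff[OF assms] matrix_2_eq_iff
      by (simp add: vector_2 w_def y_def z_def x_def)
  qed
qed

lemma hermitian_2_iff:
  fixes R :: "complex^2^2"
  shows "conj_transpose R = R \<longleftrightarrow>
    cnj (R$1$1) = R$1$1 \<and> cnj (R$2$2) = R$2$2 \<and> cnj (R$1$2) = R$2$1 \<and> cnj (R$2$1) = R$1$2"
  unfolding matrix_2_eq_iff[of "conj_transpose R"] by (auto simp: conj_transpose_def)

lemma hermitian_trace_Reals:
  fixes R :: "complex^2^2"
  assumes "conj_transpose R = R"
  shows "trace R \<in> \<real>"
  using assms unfolding hermitian_2_iff trace_def sum_2 by (simp add: Reals_cnj_iff)

text \<open>Conjugation fixes the back-substitution formulas of the diagonal entries and swaps those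
  of the off-diagonal ones. This is what makes the traces of \<open>X1\<close> and \<open>X2\<close>
  real.\<close>

lemma solves_stein_hermitian:
  fixes a b d :: complex
  assumes "a * cnj a \<noteq> 1" "a * cnj d \<noteq> 1" "d * cnj d \<noteq> 1"
    and "solves_stein (upper_triangular_2 a b d) R X" and "conj_transpose R = R"
  shows "conj_transpose X = X"
proof -
  note X = assms(4)[unfolded solves_stein_upper_triangular_iff[OF assms(1-3)]]
  note R = assms(5)[unfolded hermitian_2_iff]
  have w: "cnj (X$2$2) = X$2$2"
    using X R by (simp add: mult.commute)
  have y: "cnj (X$1$2) = X$2$1"
    using X R w by (simp add: mult.commute)
  have z: "cnj (X$2$1) = X$1$2"
    using y by (metis complex_cnj_cnj)
  have x: "X$1$1 = (R$1$1 + a * cnj b * X$1$2 + cnj a * b * X$2$1 + b * cnj b * X$2$2) / (1 - a * cnj a)"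
    using X by blast
  have "cnj (X$1$1) = X$1$1"
    unfolding x using R w y z by (simp add: ac_simps)
  with w y z show ?thesis
    unfolding hermitian_2_iff by simp
qed

text \<open>Here \<open>g\<close> is the common order of smallness of the denominators and of
  \<open>b\<close>, and \<open>s\<close> is the factor that makes \<open>R\<close> converge. One
  solution step turns the factor \<open>s\<close> into \<open>s * g\<close>.\<close>

lemma solves_stein_tendsto:
  fixes a b d :: "'x \<Rightarrow> complex" and g s :: "'x \<Rightarrow> real" and R X :: "'x \<Rightarrow> complex^2^2"
  assumes nz: "\<forall>\<^sub>F t in F. a t * cnj (a t) \<noteq> 1 \<and> a t * cnj (d t) \<noteq> 1 \<and> d t * cnj (d t) \<noteq> 1 \<and> g t \<noteq> 0"
    and stein: "\<forall>\<^sub>F t in F. solves_stein (upper_triangular_2 (a t) (b t) (d t)) (R t) (X t)"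
    and aa: "((\<lambda>t. (1 - a t * cnj (a t)) / of_real (g t)) \<longlongrightarrow> 1) F"
    and dd: "((\<lambda>t. (1 - d t * cnj (d t)) / of_real (g t)) \<longlongrightarrow> 1) F"
    and ad: "((\<lambda>t. (1 - a t * cnj (d t)) / of_real (g t)) \<longlongrightarrow> \<omega>) F" "\<omega> \<noteq> 0"
    and bg: "((\<lambda>t. b t / of_real (g t)) \<longlongrightarrow> \<beta>) F"
    and a: "(a \<longlongrightarrow> 1) F" and d: "(d \<longlongrightarrow> 1) F" and b: "(b \<longlongrightarrow> 0) F"
    and R: "\<And>i j. ((\<lambda>t. of_real (s t) * R t $ i $ j) \<longlongrightarrow> r i j) F"
  defines "y \<equiv> (r 1 2 + \<beta> * r 2 2) / \<omega>" and "z \<equiv> (r 2 1 + cnj \<beta> * r 2 2) / cnj \<omega>"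
  shows "((\<lambda>t. of_real (s t * g t) * X t $ 2 $ 2) \<longlongrightarrow> r 2 2) F"
    and "((\<lambda>t. of_real (s t * g t) * X t $ 1 $ 2) \<longlongrightarrow> y) F"
    and "((\<lambda>t. of_real (s t * g t) * X t $ 2 $ 1) \<longlongrightarrow> z) F"
    and "((\<lambda>t. of_real (s t * g t) * X t $ 1 $ 1) \<longlongrightarrow> r 1 1 + cnj \<beta> * y + \<beta> * z) F"
proof -
  have da: "((\<lambda>t. (1 - cnj (a t) * d t) / of_real (g t)) \<longlongrightarrow> cnj \<omega>) F"
    using tendsto_cnj[OF ad(1)] by simp
  have bg': "((\<lambda>t. cnj (b t) / of_real (g t)) \<longlongrightarrow> cnj \<beta>) F"
    using tendsto_cnj[OF bg] by simp
  \<comment> \<open>The formulas are rewritten so that every factor converges by itself: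
    \<open>s\<close> goes to \<open>R\<close>, one \<open>g\<close> divides each denominator, and
    one \<open>g\<close> divides a single factor \<open>b\<close> or \<open>cnj b\<close>.\<close>
  have eqs: "\<forall>\<^sub>F t in F.
     (of_real (s t) * R t $ 2 $ 2) / ((1 - d t * cnj (d t)) / of_real (g t)) = of_real (s t * g t) * X t $ 2 $ 2 \<and>
     (of_real (s t) * R t $ 1 $ 2 + b t / of_real (g t) * cnj (d t) * (of_real (s t * g t) * X t $ 2 $ 2))
        / ((1 - a t * cnj (d t)) / of_real (g t)) = of_real (s t * g t) * X t $ 1 $ 2 \<and>
     (of_real (s t) * R t $ 2 $ 1 + cnj (b t) / of_real (g t) * d t * (of_real (s t * g t) * X t $ 2 $ 2))
        / ((1 - cnj (a t) * d t) / of_real (g t)) = of_real (s t * g t) * X t $ 2 $ 1 \<and>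
     (of_real (s t) * R t $ 1 $ 1 + a t * (cnj (b t) / of_real (g t)) * (of_real (s t * g t) * X t $ 1 $ 2)
         + cnj (a t) * (b t / of_real (g t)) * (of_real (s t * g t) * X t $ 2 $ 1)
         + b t / of_real (g t) * cnj (b t) * (of_real (s t * g t) * X t $ 2 $ 2))
        / ((1 - a t * cnj (a t)) / of_real (g t)) = of_real (s t * g t) * X t $ 1 $ 1"
    (is "eventually (\<lambda>t. ?w t = _ \<and> ?y t = _ \<and> ?z t = _ \<and> ?x t = _) F")
    using nz stein
  proof eventually_elim
    case (elim t)
    then have X: "X t $ 2 $ 2 = R t $ 2 $ 2 / (1 - d t * cnj (d t))"
      "X t $ 1 $ 2 = (R t $ 1 $ 2 + b t * cnj (d t) * X t $ 2 $ 2) / (1 - a t * cnj (d t))"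
      "X t $ 2 $ 1 = (R t $ 2 $ 1 + cnj (b t) * d t * X t $ 2 $ 2) / (1 - cnj (a t) * d t)"
      "X t $ 1 $ 1 = (R t $ 1 $ 1 + a t * cnj (b t) * X t $ 1 $ 2 + cnj (a t) * b t * X t $ 2 $ 1
        + b t * cnj (b t) * X t $ 2 $ 2) / (1 - a t * cnj (a t))"
      using solves_stein_upper_triangular_iff by blast+
    define \<sigma> \<gamma> :: complex where "\<sigma> = of_real (s t)" and "\<gamma> = of_real (g t)"
    have g: "\<gamma> \<noteq> 0"
      using elim by (simp add: \<gamma>_def)
    have scale: "m / (v / \<gamma>) = \<sigma> * \<gamma> * x" if "x = n / v" "m = \<sigma> * n" for m n v x
      using that by simp
    show ?case
      unfolding of_real_mult \<sigma>_def[symmetric] \<gamma>_def[symmetric]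
      by (intro conjI X[THEN scale]) (use g in \<open>simp_all add: algebra_simps\<close>)
  qed
  note eqs' = eqs[unfolded eventually_conj_iff]
  note eq_w = eqs'[THEN conjunct1] and eq_y = eqs'[THEN conjunct2, THEN conjunct1]
    and eq_z = eqs'[THEN conjunct2, THEN conjunct2, THEN conjunct1]
    and eq_x = eqs'[THEN conjunct2, THEN conjunct2, THEN conjunct2]
  have w: "(?w \<longlongrightarrow> r 2 2) F"
    by (rule tendsto_eq_intros R dd | simp)+
  show w': "((\<lambda>t. of_real (s t * g t) * X t $ 2 $ 2) \<longlongrightarrow> r 2 2) F"
    by (rule Lim_transform_eventually[OF w eq_w])
  have y: "(?y \<longlongrightarrow> (r 1 2 + \<beta> * cnj 1 * r 2 2) / \<omega>) F"
    by (intro tendsto_intros R w' ad d bg)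
  show y': "((\<lambda>t. of_real (s t * g t) * X t $ 1 $ 2) \<longlongrightarrow> y) F"
    using tendsto_eq_rhs[OF Lim_transform_eventually[OF y eq_y]] by (simp add: y_def)
  have z: "(?z \<longlongrightarrow> (r 2 1 + cnj \<beta> * 1 * r 2 2) / cnj \<omega>) F"
    using ad(2) by (intro tendsto_intros R w' da d bg') simp
  show z': "((\<lambda>t. of_real (s t * g t) * X t $ 2 $ 1) \<longlongrightarrow> z) F"
    using tendsto_eq_rhs[OF Lim_transform_eventually[OF z eq_z]] by (simp add: z_def)
  \<comment> \<open>In the last summand the factor \<open>cnj (b t)\<close> stays unscaled and tends
    to 0, so the term quadratic in \<open>b\<close> disappears.\<close>
  have x: "(?x \<longlongrightarrow> (r 1 1 + 1 * cnj \<beta> * y + cnj 1 * \<beta> * z + \<beta> * cnj 0 * r 2 2) / 1) F"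
    by (intro tendsto_intros R w' y' z' aa a b bg bg') simp
  show "((\<lambda>t. of_real (s t * g t) * X t $ 1 $ 1) \<longlongrightarrow> r 1 1 + cnj \<beta> * y + \<beta> * z) F"
    using tendsto_eq_rhs[OF Lim_transform_eventually[OF x eq_x]] by simp
qed

section \<open>The no-tick matrix as an instance\<close>

lemma no_tick_eq:
  "no_tick \<psi> c \<gamma> = upper_triangular_2 (of_real (cos \<gamma>)) (of_real ((sin \<gamma>)\<^sup>2) * cis \<psi>)
    (of_real (cos \<gamma>) * cis (c * \<gamma>\<^sup>2))"
  by (simp add: no_tick_def upper_triangular_2_def)

text \<open>All three products have modulus \<open>(cos \<gamma>)\<^sup>2\<close>, which is below
  1.\<close>

lemma no_tick_diagonal:
  fixes c \<gamma> :: real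
  assumes "0 < \<gamma>" "\<gamma> < pi / 2"
  defines "a \<equiv> complex_of_real (cos \<gamma>)" and "d \<equiv> of_real (cos \<gamma>) * cis (c * \<gamma>\<^sup>2)"
  shows "a * cnj a \<noteq> 1" "a * cnj d \<noteq> 1" "d * cnj d \<noteq> 1"
proof -
  have "0 < cos \<gamma>" "cos \<gamma> < 1"
    using assms cos_gt_zero_pi[of \<gamma>] cos_monotone_0_pi[of 0 \<gamma>] by auto
  then have "cos \<gamma> * cos \<gamma> < 1 * 1"
    by (intro mult_strict_mono) auto
  then have "norm (a * cnj a) \<noteq> 1" "norm (a * cnj d) \<noteq> 1" "norm (d * cnj d) \<noteq> 1"
    using \<open>0 < cos \<gamma>\<close> by (simp_all add: a_def d_def norm_mult)
  then show "a * cnj a \<noteq> 1" "a * cnj d \<noteq> 1" "d * cnj d \<noteq> 1"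
    by auto
qed

lemma init_state_hermitian: "conj_transpose (init_state \<alpha>) = init_state \<alpha>"
  unfolding hermitian_2_iff by (simp add: init_state_def vector_2)

context
  fixes \<psi> c \<gamma> :: real
  assumes \<gamma>: "0 < \<gamma>" "\<gamma> < pi / 2"
begin

lemma ex1_solves_stein_no_tick: "\<exists>!X. solves_stein (no_tick \<psi> c \<gamma>) R X"
  unfolding no_tick_eq by (intro ex1_solves_stein_upper_triangular no_tick_diagonal \<gamma>)

lemma X1_solves_stein: "solves_stein (no_tick \<psi> c \<gamma>) (init_state \<alpha>) (X1 \<alpha> \<psi> c \<gamma>)"
  unfolding X1_def by (rule theI', rule ex1_solves_stein_no_tick)

lemma X2_solves_stein: "solves_stein (no_tick \<psi> c \<gamma>) (X1 \<alpha> \<psi> c \<gamma>) (X2 \<alpha> \<psi> c \<gamma>)"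
  unfolding X2_def by (rule theI', rule ex1_solves_stein_no_tick)

lemma X1_hermitian: "conj_transpose (X1 \<alpha> \<psi> c \<gamma>) = X1 \<alpha> \<psi> c \<gamma>"
  using X1_solves_stein[of \<alpha>] unfolding no_tick_eq
  by (rule solves_stein_hermitian[OF no_tick_diagonal[OF \<gamma>] _ init_state_hermitian])

lemma X2_hermitian: "conj_transpose (X2 \<alpha> \<psi> c \<gamma>) = X2 \<alpha> \<psi> c \<gamma>"
  using X2_solves_stein[of \<alpha>] unfolding no_tick_eq
  by (rule solves_stein_hermitian[OF no_tick_diagonal[OF \<gamma>] _ X1_hermitian])

end

section \<open>Behaviour for small loss angle\<close>

lemma tendsto_sin_squared_over_square: "((\<lambda>\<gamma>::real. (sin \<gamma>)\<^sup>2 / \<gamma>\<^sup>2) \<longlongrightarrow> 1) (at_right 0)"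
proof -
  have "((\<lambda>\<gamma>::real. sin \<gamma> / \<gamma>) \<longlongrightarrow> 1) (at_right 0)"
    using DERIV_sin[of "0::real"] by (simp add: has_field_derivative_iff filterlim_at_split)
  from tendsto_power[OF this, of 2] show ?thesis
    by (simp add: power_divide)
qed

text \<open>This is the derivative at 0 of \<open>1 - cis (- (c * t))\<close>, taken along
  \<open>t = \<gamma>\<^sup>2\<close>. The sign in the exponent comes from the conjugate in
  \<open>a * cnj d\<close>.\<close>

lemma tendsto_cis_difference_quotient:
  "((\<lambda>\<gamma>. (1 - cis (- (c * \<gamma>\<^sup>2))) / of_real (\<gamma>\<^sup>2)) \<longlongrightarrow> \<i> * of_real c) (at_right 0)"
proof -
  have sq: "filterlim (\<lambda>\<gamma>::real. \<gamma>\<^sup>2) (at 0) (at_right 0)"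
    unfolding filterlim_at by (auto intro!: tendsto_eq_intros simp: eventually_at_filter)
  have "((\<lambda>t. 1 - cos (c * t)) has_real_derivative 0) (at 0)"
    "((\<lambda>t. sin (c * t)) has_real_derivative c) (at 0)"
    by (auto intro!: derivative_eq_intros)
  then have "((\<lambda>t. (1 - cos (c * t)) / t) \<longlongrightarrow> 0) (at 0)" "((\<lambda>t. sin (c * t) / t) \<longlongrightarrow> c) (at 0)"
    by (simp_all add: has_field_derivative_iff)
  from this[THEN filterlim_compose[OF _ sq]]
  have "((\<lambda>\<gamma>. Complex ((1 - cos (c * \<gamma>\<^sup>2)) / \<gamma>\<^sup>2) (sin (c * \<gamma>\<^sup>2) / \<gamma>\<^sup>2)) \<longlongrightarrow> Complex 0 c) (at_right 0)"
    by (intro tendsto_Complex)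
  also have "Complex 0 c = \<i> * of_real c"
    by (simp add: complex_eq_iff)
  also have "(\<lambda>\<gamma>. Complex ((1 - cos (c * \<gamma>\<^sup>2)) / \<gamma>\<^sup>2) (sin (c * \<gamma>\<^sup>2) / \<gamma>\<^sup>2))
      = (\<lambda>\<gamma>. (1 - cis (- (c * \<gamma>\<^sup>2))) / of_real (\<gamma>\<^sup>2))"
    by (simp add: fun_eq_iff complex_eq_iff Re_divide_of_real Im_divide_of_real del: of_real_power)
  finally show ?thesis .
qed

lemma eventually_no_tick_range: "\<forall>\<^sub>F \<gamma> in at_right 0. 0 < \<gamma> \<and> \<gamma> < pi / 2"
  using eventually_at_right_real[of 0 "pi / 2"] by simp

text \<open>The instance \<open>g = \<gamma>\<^sup>2\<close>, \<open>s = \<gamma> ^ k\<close>. It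
  serves twice: with \<open>k = 0\<close> it leads from the initial state to \<open>X1\<close>, with
  \<open>k = 2\<close> from \<open>X1\<close> to \<open>X2\<close>.\<close>

lemma no_tick_stein_tendsto:
  fixes \<psi> c :: real and R X :: "real \<Rightarrow> complex^2^2"
  assumes stein: "\<forall>\<gamma>\<in>{0<..<pi / 2}. solves_stein (no_tick \<psi> c \<gamma>) (R \<gamma>) (X \<gamma>)"
    and R: "\<And>i j. ((\<lambda>\<gamma>. of_real (\<gamma> ^ k) * R \<gamma> $ i $ j) \<longlongrightarrow> r i j) (at_right 0)"
  defines "\<omega> \<equiv> 1 + \<i> * of_real c"
  defines "y \<equiv> (r 1 2 + cis \<psi> * r 2 2) / \<omega>" and "z \<equiv> (r 2 1 + cis (- \<psi>) * r 2 2) / cnj \<omega>"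
  shows "((\<lambda>\<gamma>. of_real (\<gamma> ^ (k + 2)) * X \<gamma> $ 2 $ 2) \<longlongrightarrow> r 2 2) (at_right 0)"
    and "((\<lambda>\<gamma>. of_real (\<gamma> ^ (k + 2)) * X \<gamma> $ 1 $ 2) \<longlongrightarrow> y) (at_right 0)"
    and "((\<lambda>\<gamma>. of_real (\<gamma> ^ (k + 2)) * X \<gamma> $ 2 $ 1) \<longlongrightarrow> z) (at_right 0)"
    and "((\<lambda>\<gamma>. of_real (\<gamma> ^ (k + 2)) * X \<gamma> $ 1 $ 1) \<longlongrightarrow> r 1 1 + cis (- \<psi>) * y + cis \<psi> * z) (at_right 0)"
proof -
  define a where "a \<gamma> = complex_of_real (cos \<gamma>)" for \<gamma>
  define b where "b \<gamma> = of_real ((sin \<gamma>)\<^sup>2) * cis \<psi>" for \<gamma>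
  define d where "d \<gamma> = of_real (cos \<gamma>) * cis (c * \<gamma>\<^sup>2)" for \<gamma>
  have sin2: "((\<lambda>\<gamma>. complex_of_real ((sin \<gamma>)\<^sup>2 / \<gamma>\<^sup>2)) \<longlongrightarrow> 1) (at_right 0)"
    using tendsto_of_real[where 'a = complex, OF tendsto_sin_squared_over_square] by simp
  have nz: "\<forall>\<^sub>F \<gamma> in at_right 0. a \<gamma> * cnj (a \<gamma>) \<noteq> 1 \<and> a \<gamma> * cnj (d \<gamma>) \<noteq> 1 \<and> d \<gamma> * cnj (d \<gamma>) \<noteq> 1 \<and> \<gamma>\<^sup>2 \<noteq> 0"
    using eventually_no_tick_range unfolding a_def d_def
    by (rule eventually_mono) (use no_tick_diagonal in auto)
  have stein': "\<forall>\<^sub>F \<gamma> in at_right 0. solves_stein (upper_triangular_2 (a \<gamma>) (b \<gamma>) (d \<gamma>)) (R \<gamma>) (X \<gamma>)"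
    using eventually_no_tick_range unfolding a_def b_def d_def no_tick_eq[symmetric]
    by (rule eventually_mono) (use stein in auto)
  have aa: "((\<lambda>\<gamma>. (1 - a \<gamma> * cnj (a \<gamma>)) / of_real (\<gamma>\<^sup>2)) \<longlongrightarrow> 1) (at_right 0)"
  proof -
    have "(1 - a \<gamma> * cnj (a \<gamma>)) / of_real (\<gamma>\<^sup>2) = of_real ((sin \<gamma>)\<^sup>2 / \<gamma>\<^sup>2)" for \<gamma>
      unfolding a_def sin_squared_eq by (simp add: power2_eq_square)
    with sin2 show ?thesis
      by (simp only:)
  qed
  have "d \<gamma> * cnj (d \<gamma>) = a \<gamma> * cnj (a \<gamma>)" for \<gamma>
    by (simp add: a_def d_def cis_cnj cis_mult)
  then have dd: "((\<lambda>\<gamma>. (1 - d \<gamma> * cnj (d \<gamma>)) / of_real (\<gamma>\<^sup>2)) \<longlongrightarrow> 1) (at_right 0)"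
    using aa by simp
  have a: "(a \<longlongrightarrow> 1) (at_right 0)"
    unfolding a_def by (auto intro!: tendsto_eq_intros)
  \<comment> \<open>Loss and phase are separated: \<open>1 - a * cnj d\<close> is
    \<open>1 - a * cnj a\<close>, which gives the 1 in \<open>\<omega>\<close>, plus
    \<open>a\<^sup>2\<close> times the phase defect, which gives the imaginary part.\<close>
  have "((\<lambda>\<gamma>. (1 - a \<gamma> * cnj (a \<gamma>)) / of_real (\<gamma>\<^sup>2)
      + (a \<gamma>)\<^sup>2 * ((1 - cis (- (c * \<gamma>\<^sup>2))) / of_real (\<gamma>\<^sup>2))) \<longlongrightarrow> 1 + 1\<^sup>2 * (\<i> * of_real c)) (at_right 0)"
    by (intro tendsto_intros aa a tendsto_cis_difference_quotient)
  also have "(\<lambda>\<gamma>. (1 - a \<gamma> * cnj (a \<gamma>)) / of_real (\<gamma>\<^sup>2) + (a \<gamma>)\<^sup>2 * ((1 - cis (- (c * \<gamma>\<^sup>2))) / of_real (\<gamma>\<^sup>2)))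
      = (\<lambda>\<gamma>. (1 - a \<gamma> * cnj (d \<gamma>)) / of_real (\<gamma>\<^sup>2))"
    by (simp add: fun_eq_iff a_def d_def cis_cnj power2_eq_square right_diff_distrib mult.assoc
        flip: add_divide_distrib)
  finally have ad: "((\<lambda>\<gamma>. (1 - a \<gamma> * cnj (d \<gamma>)) / of_real (\<gamma>\<^sup>2)) \<longlongrightarrow> \<omega>) (at_right 0)"
    by (simp add: \<omega>_def)
  have "\<omega> \<noteq> 0"
    by (simp add: \<omega>_def complex_eq_iff)
  have "((\<lambda>\<gamma>. of_real ((sin \<gamma>)\<^sup>2 / \<gamma>\<^sup>2) * cis \<psi>) \<longlongrightarrow> 1 * cis \<psi>) (at_right 0)"
    by (intro tendsto_intros sin2)
  then have bg: "((\<lambda>\<gamma>. b \<gamma> / of_real (\<gamma>\<^sup>2)) \<longlongrightarrow> cis \<psi>) (at_right 0)"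
    by (simp add: b_def)
  have b: "(b \<longlongrightarrow> 0) (at_right 0)"
    unfolding b_def by (auto intro!: tendsto_eq_intros)
  have d: "(d \<longlongrightarrow> 1) (at_right 0)"
    unfolding d_def cis_conv_exp by (auto intro!: tendsto_eq_intros)
  note lims = solves_stein_tendsto[OF nz stein' aa dd ad \<open>\<omega> \<noteq> 0\<close> bg a d b R]
  show "((\<lambda>\<gamma>. of_real (\<gamma> ^ (k + 2)) * X \<gamma> $ 2 $ 2) \<longlongrightarrow> r 2 2) (at_right 0)"
    using lims(1) by (simp only: power_add)
  show "((\<lambda>\<gamma>. of_real (\<gamma> ^ (k + 2)) * X \<gamma> $ 1 $ 2) \<longlongrightarrow> y) (at_right 0)"
    using lims(2) by (simp only: power_add y_def)
  show "((\<lambda>\<gamma>. of_real (\<gamma> ^ (k + 2)) * X \<gamma> $ 2 $ 1) \<longlongrightarrow> z) (at_right 0)"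
    using lims(3) by (simp only: power_add z_def cis_cnj)
  show "((\<lambda>\<gamma>. of_real (\<gamma> ^ (k + 2)) * X \<gamma> $ 1 $ 1) \<longlongrightarrow> r 1 1 + cis (- \<psi>) * y + cis \<psi> * z) (at_right 0)"
    using lims(4) by (simp only: power_add y_def z_def cis_cnj)
qed

section \<open>Limits of the scaled traces and moments\<close>

lemma trace_2: "trace (A :: 'a::semiring_1^2^2) = A$1$1 + A$2$2"
  by (simp add: trace_def sum_2)

text \<open>Two solution steps are followed from the initial state. The off-diagonal entries
  contribute conjugate pairs, so the limits are \<open>1 + 2 * Re u\<close> and
  \<open>1 + 2 * Re u + 2 * Re v\<close>.\<close>

lemma scaled_traces_tendsto:
  shows "((\<lambda>\<gamma>. of_real (\<gamma>^2) * trace (X1 \<alpha> \<psi> c \<gamma>)) \<longlongrightarrow> of_real (N1 \<alpha> \<psi> c)) (at_right 0)"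
    and "((\<lambda>\<gamma>. of_real (\<gamma>^4) * trace (X2 \<alpha> \<psi> c \<gamma>)) \<longlongrightarrow> of_real (N2 \<alpha> \<psi> c)) (at_right 0)"
proof -
  define \<omega> where "\<omega> = 1 + \<i> * of_real c"
  define r where "r i j = init_state \<alpha> $ i $ j" for i j
  define y z x where "y = (r 1 2 + cis \<psi> * r 2 2) / \<omega>" and "z = (r 2 1 + cis (- \<psi>) * r 2 2) / cnj \<omega>"
    and "x = r 1 1 + cis (- \<psi>) * y + cis \<psi> * z"
  have R_lim: "((\<lambda>\<gamma>. of_real (\<gamma> ^ 0) * init_state \<alpha> $ i $ j) \<longlongrightarrow> r i j) (at_right 0)" for i j
    by (simp add: r_def)
  have X_stein: "\<forall>\<gamma>\<in>{0<..<pi / 2}. solves_stein (no_tick \<psi> c \<gamma>) (init_state \<alpha>) (X1 \<alpha> \<psi> c \<gamma>)"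
    using X1_solves_stein by simp
  note lim1 = no_tick_stein_tendsto[OF X_stein R_lim, folded \<omega>_def, folded y_def z_def, folded x_def]
  \<comment> \<open>The limit of the scaled \<open>X1\<close>, packaged by indices as the input of
    the second solution step.\<close>
  define r1 :: "2 \<Rightarrow> 2 \<Rightarrow> complex"
    where "r1 i j = (if i = 1 then if j = 1 then x else y else if j = 1 then z else r 2 2)" for i j
  have "(2::2) \<noteq> 1"
    by simp
  have R_lim: "((\<lambda>\<gamma>. of_real (\<gamma> ^ (0 + 2)) * X1 \<alpha> \<psi> c \<gamma> $ i $ j) \<longlongrightarrow> r1 i j) (at_right 0)" for i j
    using exhaust_2[of i] exhaust_2[of j] lim1 \<open>(2::2) \<noteq> 1\<close>
    by (elim disjE) (simp_all only: r1_def if_True if_False refl)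
  have X_stein: "\<forall>\<gamma>\<in>{0<..<pi / 2}. solves_stein (no_tick \<psi> c \<gamma>) (X1 \<alpha> \<psi> c \<gamma>) (X2 \<alpha> \<psi> c \<gamma>)"
    using X2_solves_stein by simp
  note lim2 = no_tick_stein_tendsto[OF X_stein R_lim, folded \<omega>_def]
  define p k where "p = (sin \<alpha>)\<^sup>2" and "k = cos \<alpha> * sin \<alpha>"
  have r: "r 1 1 = of_real ((cos \<alpha>)\<^sup>2)" "r 1 2 = of_real k" "r 2 1 = of_real k" "r 2 2 = of_real p"
    by (simp_all add: r_def init_state_def vector_2 p_def k_def)
  have k: "sin (2 * \<alpha>) = 2 * k"
    by (simp add: k_def sin_double)
  \<comment> \<open>The contribution of the (1,2) entry to the (1,1) limit in the first step; the
    (2,1) entry contributes the conjugate.\<close>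
  define u where "u = cis (- \<psi>) * y"
  have u: "u = (of_real k * cis (- \<psi>) + of_real p) / \<omega>"
    by (simp add: u_def y_def r distrib_left cis_mult mult.assoc[symmetric])
  have z: "cis \<psi> * z = cnj u"
    by (simp add: u z_def r distrib_left cis_mult cis_cnj mult.assoc[symmetric])
  \<comment> \<open>The corresponding contribution in the second step: \<open>u\<close> is divided
    by \<open>\<omega>\<close> once more, and the unchanged (2,2) limit feeds in again.\<close>
  define v where "v = (of_real k * cis (- \<psi>) + of_real p) / \<omega>\<^sup>2 + of_real p / \<omega>"
  have y': "cis (- \<psi>) * ((y + cis \<psi> * r 2 2) / \<omega>) = v"
  proof -
    have "cis (- \<psi>) * ((y + cis \<psi> * r 2 2) / \<omega>) = (u + (cis (- \<psi>) * cis \<psi>) * r 2 2) / \<omega>"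
      by (simp add: u_def algebra_simps)
    also have "\<dots> = v"
      by (simp add: cis_mult u v_def r power2_eq_square add_divide_distrib)
    finally show ?thesis .
  qed
  have z': "cis \<psi> * ((z + cis (- \<psi>) * r 2 2) / cnj \<omega>) = cnj v"
  proof -
    have "cis \<psi> * ((z + cis (- \<psi>) * r 2 2) / cnj \<omega>) = (cnj u + (cis \<psi> * cis (- \<psi>)) * r 2 2) / cnj \<omega>"
      by (simp add: z[symmetric] algebra_simps)
    also have "\<dots> = cnj v"
      by (simp add: cis_mult u v_def r power2_eq_square add_divide_distrib)
    finally show ?thesis .
  qed
  have Q: "1 + c\<^sup>2 \<noteq> 0"
    by (metis add_pos_nonneg less_irrefl zero_le_power2 zero_less_one)
  have "Re \<omega> = 1" "Im \<omega> = c"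
    by (simp_all add: \<omega>_def)
  moreover have "Re (\<omega>\<^sup>2) = 1 - c\<^sup>2" "Im (\<omega>\<^sup>2) = 2 * c"
    by (simp_all add: \<omega>_def power2_eq_square)
  \<comment> \<open>Both sides are the squared modulus of \<open>\<omega>\<^sup>2\<close>, the
    denominator that arises in \<open>Re v\<close>.\<close>
  moreover have "(1 - c\<^sup>2)\<^sup>2 + (2 * c)\<^sup>2 = (1 + c\<^sup>2)\<^sup>2"
    by algebra
  ultimately have Re_u: "Re u = (k * cos \<psi> + p - c * (k * sin \<psi>)) / (1 + c\<^sup>2)"
    and Re_v: "Re v = ((k * cos \<psi> + p) * (1 - c\<^sup>2) - k * sin \<psi> * (2 * c)) / (1 + c\<^sup>2)\<^sup>2 + p / (1 + c\<^sup>2)"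
    unfolding u v_def by (simp_all add: Re_divide del: power_mult_distrib)
  have "1 + 2 * Re u = N1 \<alpha> \<psi> c"
    unfolding Re_u N1_def k p_def[symmetric]
    by (simp add: algebra_simps diff_divide_distrib add_divide_distrib)
  then have trace1: "x + r 2 2 = of_real (N1 \<alpha> \<psi> c)"
    unfolding x_def z u_def[symmetric] by (simp add: r p_def cos_squared_eq complex_eq_iff)
  have "1 + 2 * Re u + 2 * Re v = N2 \<alpha> \<psi> c"
  proof -
    define q where "q = 1 + c\<^sup>2"
    have "q \<noteq> 0" and c2: "c\<^sup>2 = q - 1"
      using Q by (simp_all add: q_def)
    then show ?thesis
      unfolding Re_u Re_v N2_def k p_def[symmetric] q_def[symmetric] c2
      by (simp add: field_simps power2_eq_square)
  qed
  then have trace2: "(x + cis (- \<psi>) * ((y + cis \<psi> * r 2 2) / \<omega>) + cis \<psi> * ((z + cis (- \<psi>) * r 2 2) / cnj \<omega>)) + r 2 2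
      = of_real (N2 \<alpha> \<psi> c)"
    unfolding x_def z u_def[symmetric] y' z' by (simp add: r p_def cos_squared_eq complex_eq_iff)
  show "((\<lambda>\<gamma>. of_real (\<gamma>^2) * trace (X1 \<alpha> \<psi> c \<gamma>)) \<longlongrightarrow> of_real (N1 \<alpha> \<psi> c)) (at_right 0)"
    using tendsto_add[OF lim1(4) lim1(1)] unfolding trace1 by (simp only: trace_2 distrib_left add_0_left)
  show "((\<lambda>\<gamma>. of_real (\<gamma>^4) * trace (X2 \<alpha> \<psi> c \<gamma>)) \<longlongrightarrow> of_real (N2 \<alpha> \<psi> c)) (at_right 0)"
  proof -
    \<comment> \<open>The exponent must have the shape \<open>k + 2\<close> with
      \<open>k = 0 + 2\<close> to match the second limit.\<close>
    have "(4::nat) = 0 + 2 + 2"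
      by simp
    then show ?thesis
      using tendsto_add[OF lim2(4) lim2(1)] trace2 \<open>(2::2) \<noteq> 1\<close>
      by (simp only: trace_2 distrib_left r1_def if_True if_False refl)
  qed
qed

lemma trace_X1_real:
  assumes "0 < \<gamma>" "\<gamma> < pi / 2"
  shows "trace (X1 \<alpha> \<psi> c \<gamma>) \<in> \<real>"
  using X1_hermitian[OF assms] by (rule hermitian_trace_Reals)

lemma trace_X2_real:
  assumes "0 < \<gamma>" "\<gamma> < pi / 2"
  shows "trace (X2 \<alpha> \<psi> c \<gamma>) \<in> \<real>"
  using X2_hermitian[OF assms] by (rule hermitian_trace_Reals)

lemma asymp_equiv_of_scaled_limit:
  fixes f :: "real \<Rightarrow> complex"
  assumes "((\<lambda>\<gamma>. of_real (\<gamma> ^ k) * f \<gamma>) \<longlongrightarrow> of_real n) (at_right 0)" and "n \<noteq> 0"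
  shows "f \<sim>[at_right 0] (\<lambda>\<gamma>. of_real (n / \<gamma> ^ k))"
proof (rule asymp_equivI')
  have "((\<lambda>\<gamma>. of_real (\<gamma> ^ k) * f \<gamma> / of_real n) \<longlongrightarrow> of_real n / of_real n) (at_right 0)"
    using assms by (intro tendsto_intros) simp_all
  then show "((\<lambda>\<gamma>. f \<gamma> / of_real (n / \<gamma> ^ k)) \<longlongrightarrow> 1) (at_right 0)"
    using \<open>n \<noteq> 0\<close> by (simp add: mult.commute)
qed

lemma scaled_moments_tendsto:
  shows "((\<lambda>\<gamma>. \<gamma>^2 * tick_mean \<alpha> \<psi> c \<gamma>) \<longlongrightarrow> N1 \<alpha> \<psi> c) (at_right 0)"
    and "((\<lambda>\<gamma>. \<gamma>^4 * Re (trace (X2 \<alpha> \<psi> c \<gamma>))) \<longlongrightarrow> N2 \<alpha> \<psi> c) (at_right 0)"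
  using scaled_traces_tendsto[of \<alpha> \<psi> c, THEN tendsto_Re]
  by (simp_all add: tick_mean_def del: of_real_power)

lemma tick_mean_at_top:
  assumes "0 < N1 \<alpha> \<psi> c"
  shows "filterlim (tick_mean \<alpha> \<psi> c) at_top (at_right 0)"
proof -
  have "((\<lambda>\<gamma>::real. \<gamma>\<^sup>2) \<longlongrightarrow> 0) (at_right 0)"
    by (auto intro!: tendsto_eq_intros)
  moreover have "\<forall>\<^sub>F \<gamma>::real in at_right 0. 0 < \<gamma>\<^sup>2"
    by (simp add: eventually_at_filter)
  ultimately have "filterlim (\<lambda>\<gamma>. \<gamma>\<^sup>2 * tick_mean \<alpha> \<psi> c \<gamma> / \<gamma>\<^sup>2) at_top (at_right 0)"
    by (rule LIM_at_top_divide[OF scaled_moments_tendsto(1) assms])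
  then show ?thesis
    by (rule filterlim_mono_eventually) (auto simp: eventually_at_filter)
qed

lemma CF2_ratio_tendsto:
  assumes "0 < N1 \<alpha> \<psi> c"
  shows "((\<lambda>\<gamma>. CF2 \<alpha> \<psi> c \<gamma> / (tick_mean \<alpha> \<psi> c \<gamma>)^2) \<longlongrightarrow> asymp_ratio \<alpha> \<psi> c) (at_right 0)"
proof -
  let ?\<mu> = "tick_mean \<alpha> \<psi> c" and ?t = "\<lambda>\<gamma>. Re (trace (X2 \<alpha> \<psi> c \<gamma>))"
  have "((\<lambda>\<gamma>. 4 * (\<gamma>^4 * ?t \<gamma>) / (\<gamma>^2 * ?\<mu> \<gamma>)^2 - 3) \<longlongrightarrow> asymp_ratio \<alpha> \<psi> c) (at_right 0)"
    unfolding asymp_ratio_def using assms by (intro tendsto_intros scaled_moments_tendsto) simp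
  \<comment> \<open>Positivity excludes \<open>\<gamma> = 0\<close> and a vanishing mean, so the
    powers of \<gamma> may be cancelled.\<close>
  moreover have "\<forall>\<^sub>F \<gamma> in at_right 0. 0 < \<gamma>^2 * ?\<mu> \<gamma>"
    using scaled_moments_tendsto(1) assms by (rule order_tendstoD)
  then have "\<forall>\<^sub>F \<gamma> in at_right 0. 4 * (\<gamma>^4 * ?t \<gamma>) / (\<gamma>^2 * ?\<mu> \<gamma>)^2 - 3 = CF2 \<alpha> \<psi> c \<gamma> / (?\<mu> \<gamma>)^2"
  proof eventually_elim
    case (elim \<gamma>)
    then have "\<gamma> \<noteq> 0" "?\<mu> \<gamma> \<noteq> 0"
      by auto
    then show ?case
      unfolding CF2_def by (simp add: diff_divide_distrib power_mult_distrib)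
  qed
  ultimately show ?thesis
    by (rule Lim_transform_eventually)
qed

section \<open>The minimum of the asymptotic ratio\<close>

text \<open>This is H of the overview: for \<open>q = 1 + c\<^sup>2\<close> and
  \<open>l = 2 * q / (q + 2 + x)\<close>, a quarter of the maximum of
  \<open>2 * l * N1 - l\<^sup>2 * N2\<close> over the Bloch sphere.\<close>

definition score :: "real \<Rightarrow> real \<Rightarrow> real" where
  "score q x = ((q + 1) * x + 2 * q + sqrt ((q + x)\<^sup>2 + q * x\<^sup>2)) / (q + 2 + x)\<^sup>2"

text \<open>Decimal approximations: \<open>h\<^sub>0\<close> lies just below the maximum of the score, and \<open>(q\<^sub>0, x\<^sub>0)\<close> is close to
  its maximizer.\<close>

definition h\<^sub>0 :: real where "h\<^sub>0 = 0.416353858797993"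
definition q\<^sub>0 :: real where "q\<^sub>0 = 2.0731570874"
definition x\<^sub>0 :: real where "x\<^sub>0 = 1.5462159141"

section \<open>Sum-of-squares certificate for the score\<close>

text \<open>One rule expands both \<open>K\<^sup>2\<close> and the squares of the certificate, with
  the monomials bracketed as atoms for linear arithmetic.\<close>

lemma bivariate_quadratic_squared:
  fixes p y :: real
  shows "(a * p^2 + b * (p * y) + c * y^2 + d * p + e * y + f)^2 =
    a^2 * p^4 + 2 * a * b * (p^3 * y) + (2 * a * c + b^2) * (p^2 * y^2) + 2 * b * c * (p * y^3)
    + c^2 * y^4 + 2 * a * d * p^3 + (2 * a * e + 2 * b * d) * (p^2 * y)
    + (2 * b * e + 2 * c * d) * (p * y^2) + 2 * c * e * y^3 + (d^2 + 2 * a * f) * p^2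
    + (2 * d * e + 2 * b * f) * (p * y) + (e^2 + 2 * c * f) * y^2
    + 2 * d * f * p + 2 * e * f * y + f^2"
  by algebra

text \<open>A margin without the factor \<open>q - 1/2\<close> is impossible: \<open>K^2 - ((q + x)^2 + q x^2)\<close> vanishes at
  \<open>q = 0, x = -2\<close>.\<close>

lemma score_certificate_shifted:
  fixes p y :: real
  defines "q \<equiv> p + q\<^sub>0" and "x \<equiv> y + x\<^sub>0"
  defines "K \<equiv> h\<^sub>0 * (q + 2 + x)\<^sup>2 - (q + 1) * x - 2 * q"
  shows "1/20 * (q - 1/2) * (p\<^sup>2 + y\<^sup>2) \<le> K\<^sup>2 - ((q + x)\<^sup>2 + q * x\<^sup>2) + 1 / 10^13"
proof -
  have K: "K = h\<^sub>0 * p^2 + (2 * h\<^sub>0 - 1) * (p * y) + h\<^sub>0 * y^2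
      + (2 * h\<^sub>0 * (q\<^sub>0 + 2 + x\<^sub>0) - x\<^sub>0 - 2) * p + (2 * h\<^sub>0 * (q\<^sub>0 + 2 + x\<^sub>0) - q\<^sub>0 - 1) * y
      + (h\<^sub>0 * (q\<^sub>0 + 2 + x\<^sub>0)^2 - (q\<^sub>0 + 1) * x\<^sub>0 - 2 * q\<^sub>0)"
    unfolding K_def q_def x_def by algebra
  have rest: "(q + x)^2 + q * x^2 = p * y^2 + p^2 + (1 + q\<^sub>0) * y^2 + (2 + 2 * x\<^sub>0) * (p * y)
      + (2 * (q\<^sub>0 + x\<^sub>0) + x\<^sub>0^2) * p + (2 * (q\<^sub>0 + x\<^sub>0) + 2 * q\<^sub>0 * x\<^sub>0) * y
      + ((q\<^sub>0 + x\<^sub>0)^2 + q\<^sub>0 * x\<^sub>0^2)"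
    unfolding q_def x_def by algebra
  have margin: "1/20 * (q - 1/2) * (p^2 + y^2)
      = 1/20 * p^3 + 1/20 * (p * y^2) + 1/20 * (q\<^sub>0 - 1/2) * p^2 + 1/20 * (q\<^sub>0 - 1/2) * y^2"
    unfolding q_def by algebra
  \<comment> \<open>The rounded \<open>L D L\<^sup>T\<close> factors of a numerically computed Gram matrix; what is left over has tiny
    coefficients off its diagonal, and these are absorbed by \<open>small\<close>.\<close>
  have main: "0 \<le>
      0.17305 * (1 * p^2 + (- 0.4025) * (p * y) + 0.286 * y^2 + 2.5817 * p + 0.0189 * y + 0)^2
    + 0.24735 * (0 * p^2 + 1 * (p * y) + (- 0.201) * y^2 + 2.651 * p + (- 0.3098) * y + 0)^2
    + 0.14889 * (0 * p^2 + 0 * (p * y) + 1 * y^2 + (- 1.6116) * p + 4.3815 * y + 0)^2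
    + 0.46489 * (0 * p^2 + 0 * (p * y) + 0 * y^2 + 1 * p + (- 0.4111) * y + 0)^2"
    by (intro add_nonneg_nonneg mult_nonneg_nonneg) simp_all
  \<comment> \<open>Each leftover monomial is bounded on one side by pure squares. The shifts by
    \<open>1/10^5\<close> trade the linear terms for squares and a tiny constant, which is covered
    by the slack \<open>1 / 10^13\<close>.\<close>
  have "0 \<le> (p^2 - p * y)^2" "0 \<le> (p * y - y^2)^2" "0 \<le> (p^2 - p)^2" "0 \<le> (p^2 - y)^2"
    "0 \<le> (p * y - y)^2" "0 \<le> (y^2 + y)^2" "0 \<le> (p - y)^2" "0 \<le> (p - 1/10^5)^2" "0 \<le> (y + 1/10^5)^2"
    by simp_all
  then have small: "2 * (p^3 * y) \<le> p^4 + p^2 * y^2" "2 * (p * y^3) \<le> p^2 * y^2 + y^4"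
    "2 * p^3 \<le> p^4 + p^2" "2 * (p^2 * y) \<le> p^4 + y^2" "2 * (p * y^2) \<le> p^2 * y^2 + y^2"
    "- 2 * y^3 \<le> y^4 + y^2" "2 * (p * y) \<le> p^2 + y^2"
    "2 / 10^5 * p \<le> p^2 + 1/10^10" "- 2 / 10^5 * y \<le> y^2 + 1/10^10"
    by (simp_all add: power2_eq_square power3_eq_cube power4_eq_xxxx algebra_simps)
  have nonneg: "0 \<le> p^4" "0 \<le> p^2 * y^2" "0 \<le> y^4" "0 \<le> p^2" "0 \<le> y^2"
    by simp_all
  show ?thesis
    unfolding margin rest K bivariate_quadratic_squared h\<^sub>0_def q\<^sub>0_def x\<^sub>0_def
    using main[unfolded bivariate_quadratic_squared] small
    by (simp add: power2_eq_square[of "numeral _"] power_divide add_divide_distrib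
        diff_divide_distrib mult.commute[of y "p\<^sup>2"])
      (use nonneg in linarith)
qed

lemma score_certificate:
  fixes q x :: real
  defines "K \<equiv> h\<^sub>0 * (q + 2 + x)\<^sup>2 - (q + 1) * x - 2 * q"
  shows "1/20 * (q - 1/2) * ((q - q\<^sub>0)\<^sup>2 + (x - x\<^sub>0)\<^sup>2) \<le> K\<^sup>2 - ((q + x)\<^sup>2 + q * x\<^sup>2) + 1 / 10^13"
  using score_certificate_shifted[of "q - q\<^sub>0" "x - x\<^sub>0"] unfolding K_def by simp

text \<open>Rounding \<open>h\<^sub>0\<close> down to 0.416 leaves a sum of squares plus a positive
  constant. The sign is what allows \<open>sqrt (..) \<le> K\<close> to be squared.\<close>

lemma score_residual_pos:
  fixes q x :: real
  shows "0 < h\<^sub>0 * (q + 2 + x)\<^sup>2 - (q + 1) * x - 2 * q"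
proof -
  have "0.416 * (q + 2 + x)\<^sup>2 - (q + 1) * x - 2 * q
      = 0.084 * (q - x)\<^sup>2 + 0.332 * (x + 1)\<^sup>2 + 0.168 * (q - 1)\<^sup>2 + 0.164 * q\<^sup>2 + 1.164"
    by (simp add: power2_eq_square field_simps)
  also have "\<dots> > 0"
    by (intro add_nonneg_pos add_nonneg_nonneg mult_nonneg_nonneg) simp_all
  finally have "0 < 0.416 * (q + 2 + x)\<^sup>2 - (q + 1) * x - 2 * q" .
  moreover have "0.416 * (q + 2 + x)\<^sup>2 \<le> h\<^sub>0 * (q + 2 + x)\<^sup>2"
    by (intro mult_right_mono) (simp_all add: h\<^sub>0_def)
  ultimately show ?thesis
    by linarith
qed

lemma score_le:
  assumes "1 \<le> q" and "0 < q + 2 + x"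
  shows "score q x \<le> h\<^sub>0 + 1 / 10^6 / (q + 2 + x)\<^sup>2"
proof -
  define K where "K = h\<^sub>0 * (q + 2 + x)\<^sup>2 - (q + 1) * x - 2 * q"
  have "0 \<le> 1/20 * (q - 1/2) * ((q - q\<^sub>0)\<^sup>2 + (x - x\<^sub>0)\<^sup>2)"
    using assms by simp
  then have "(q + x)\<^sup>2 + q * x\<^sup>2 \<le> K\<^sup>2 + 1 / 10^13"
    using score_certificate[of q x] unfolding K_def by linarith
  \<comment> \<open>Since \<open>K\<close> is positive and
    \<open>(1 / 10^6)\<^sup>2 = 1 / 10^12\<close> exceeds the slack.\<close>
  also have "\<dots> \<le> (K + 1 / 10^6)\<^sup>2"
    using score_residual_pos[of q x] unfolding K_def[symmetric]
    by (simp add: power2_sum power_divide)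
  finally have "sqrt ((q + x)\<^sup>2 + q * x\<^sup>2) \<le> K + 1 / 10^6"
    using score_residual_pos[of q x] by (intro real_le_lsqrt) (simp_all add: K_def)
  then have "score q x \<le> (h\<^sub>0 * (q + 2 + x)\<^sup>2 + 1 / 10^6) / (q + 2 + x)\<^sup>2"
    unfolding score_def K_def by (intro divide_right_mono) simp_all
  also have "\<dots> = h\<^sub>0 + 1 / 10^6 / (q + 2 + x)\<^sup>2"
    using assms by (simp add: add_divide_distrib)
  finally show ?thesis .
qed

section \<open>Localization and existence of the maximizer\<close>

text \<open>A score of at least \<open>h\<^sub>0\<close> means that \<open>K\<close> is at most the
  square root, so the margin of the certificate is at most \<open>1 / 10^13\<close>. As
  \<open>q - 1/2\<close> is at least 1/2, the squared distance \<open>d\<close> is at most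
  \<open>4 / 10^12\<close>.\<close>

lemma near_optimum:
  assumes "1 \<le> q" and "0 < q + 2 + x" and "h\<^sub>0 \<le> score q x"
  shows "\<bar>q - q\<^sub>0\<bar> \<le> 2 / 10^6" and "\<bar>x - x\<^sub>0\<bar> \<le> 2 / 10^6"
proof -
  define K where "K = h\<^sub>0 * (q + 2 + x)\<^sup>2 - (q + 1) * x - 2 * q"
  define d where "d = (q - q\<^sub>0)\<^sup>2 + (x - x\<^sub>0)\<^sup>2"
  have "K \<le> sqrt ((q + x)\<^sup>2 + q * x\<^sup>2)"
    using assms unfolding score_def K_def by (simp add: field_simps)
  then have "K\<^sup>2 \<le> (sqrt ((q + x)\<^sup>2 + q * x\<^sup>2))\<^sup>2"
    using score_residual_pos[of q x] unfolding K_def[symmetric] by (intro power_mono) simp_all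
  also have "\<dots> = (q + x)\<^sup>2 + q * x\<^sup>2"
    using assms by simp
  finally have "1/20 * (q - 1/2) * d \<le> 1 / 10^13"
    using score_certificate[of q x] unfolding K_def d_def by linarith
  moreover have "1/20 * (1/2) * d \<le> 1/20 * (q - 1/2) * d"
    using assms by (intro mult_right_mono) (simp_all add: d_def)
  ultimately have "1/20 * (1/2) * d \<le> 1 / 10^13"
    by linarith
  then have "d \<le> (2 / 10^6)\<^sup>2"
    by (simp add: power_divide)
  then have "(q - q\<^sub>0)\<^sup>2 \<le> (2 / 10^6)\<^sup>2" "(x - x\<^sub>0)\<^sup>2 \<le> (2 / 10^6)\<^sup>2"
    unfolding d_def by (smt (verit) zero_le_power2)+
  then show "\<bar>q - q\<^sub>0\<bar> \<le> 2 / 10^6" and "\<bar>x - x\<^sub>0\<bar> \<le> 2 / 10^6"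
    by (metis abs_le_square_iff abs_of_nonneg divide_nonneg_nonneg zero_le_numeral zero_le_power)+
qed

lemma h\<^sub>0_le_score: "h\<^sub>0 \<le> score q\<^sub>0 x\<^sub>0"
proof -
  have "h\<^sub>0 * (q\<^sub>0 + 2 + x\<^sub>0)\<^sup>2 - (q\<^sub>0 + 1) * x\<^sub>0 - 2 * q\<^sub>0 \<le> sqrt ((q\<^sub>0 + x\<^sub>0)\<^sup>2 + q\<^sub>0 * x\<^sub>0\<^sup>2)"
    by (intro real_le_rsqrt) (simp add: h\<^sub>0_def q\<^sub>0_def x\<^sub>0_def power2_eq_square)
  then show ?thesis
    unfolding score_def by (simp add: field_simps q\<^sub>0_def x\<^sub>0_def)
qed

text \<open>The domain is not compact, but every point with score at least \<open>h\<^sub>0\<close>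
  lies in a small box. A maximizer over a compact box containing them is therefore global.\<close>

lemma score_attains_max:
  obtains q x where "1 \<le> q" "0 < q + 2 + x" "h\<^sub>0 \<le> score q x"
    "\<And>q' x'. 1 \<le> q' \<Longrightarrow> 0 < q' + 2 + x' \<Longrightarrow> score q' x' \<le> score q x"
proof -
  define B :: "(real \<times> real) set" where "B = {1..3} \<times> {0..3}"
  have "compact B" "B \<noteq> {}"
    by (auto simp: B_def intro!: compact_Times)
  moreover have "continuous_on B (\<lambda>z. score (fst z) (snd z))"
    unfolding score_def by (intro continuous_intros) (auto simp: B_def)
  ultimately obtain z where z: "z \<in> B"
    and max: "\<forall>w\<in>B. score (fst w) (snd w) \<le> score (fst z) (snd z)"
    using continuous_attains_sup by blast
  have "(q\<^sub>0, x\<^sub>0) \<in> B"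
    by (simp add: B_def q\<^sub>0_def x\<^sub>0_def)
  with max have "score q\<^sub>0 x\<^sub>0 \<le> score (fst z) (snd z)"
    by (metis fst_conv snd_conv)
  with h\<^sub>0_le_score have h: "h\<^sub>0 \<le> score (fst z) (snd z)"
    by linarith
  show thesis
  proof (rule that)
    show "1 \<le> fst z" "0 < fst z + 2 + snd z"
      using z by (auto simp: B_def)
    show "score q' x' \<le> score (fst z) (snd z)" if "1 \<le> q'" "0 < q' + 2 + x'" for q' x'
    proof (cases "h\<^sub>0 \<le> score q' x'")
      case True
      from near_optimum[OF that True] have "(q', x') \<in> B"
        unfolding abs_le_iff by (simp add: B_def q\<^sub>0_def x\<^sub>0_def)
      with max show ?thesis
        by (metis fst_conv snd_conv)
    next
      case False
      with h show ?thesis by linarith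
    qed
  qed (fact h)
qed

section \<open>Passing between the ratio and the score\<close>

text \<open>Up to the factor \<open>(q + 2 + x)\<^sup>2 / 4\<close> the left side is
  \<open>2 * l * N1 - l\<^sup>2 * N2\<close>. It is affine in the Bloch vector, and the parameter
  \<open>x\<close> is chosen so that the coefficient vector becomes
  \<open>(q + x, - c * x, - x)\<close>.\<close>

lemma N1_N2_combination:
  fixes \<alpha> \<psi> c x :: real
  defines "q \<equiv> 1 + c\<^sup>2"
  shows "(q + 2 + x) * q * N1 \<alpha> \<psi> c - q\<^sup>2 * N2 \<alpha> \<psi> c = (q + 1) * x + 2 * q
    + ((q + x) * (sin (2 * \<alpha>) * cos \<psi>) - c * x * (sin (2 * \<alpha>) * sin \<psi>) - x * cos (2 * \<alpha>))"
proof -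
  have "q \<noteq> 0" and c: "c\<^sup>2 = q - 1"
    by (auto simp: q_def sum_power2_eq_zero_iff add_nonneg_eq_0_iff)
  have s: "(sin \<alpha>)\<^sup>2 = (1 - cos (2 * \<alpha>)) / 2"
    by (simp add: cos_double_sin)
  have "q * N1 \<alpha> \<psi> c = q + (1 - cos (2 * \<alpha>)) + (cos \<psi> - c * sin \<psi>) * sin (2 * \<alpha>)"
    using \<open>q \<noteq> 0\<close> unfolding N1_def q_def[symmetric] s by (simp add: field_simps)
  moreover have "q\<^sup>2 * N2 \<alpha> \<psi> c = q\<^sup>2 + (q + 2) * (1 - cos (2 * \<alpha>))
      + (2 * cos \<psi> - c * (q + 2) * sin \<psi>) * sin (2 * \<alpha>)"
    using \<open>q \<noteq> 0\<close> unfolding N2_def q_def[symmetric] s c by (simp add: field_simps power2_eq_square)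
  ultimately show ?thesis
    by algebra
qed

text \<open>Cauchy-Schwarz by Lagrange's identity.\<close>

lemma dot_le_sqrt_3:
  fixes a b c u v w :: real
  assumes "u\<^sup>2 + v\<^sup>2 + w\<^sup>2 = 1"
  shows "a * u + b * v + c * w \<le> sqrt (a\<^sup>2 + b\<^sup>2 + c\<^sup>2)"
proof (rule real_le_rsqrt)
  have "(a * u + b * v + c * w)\<^sup>2 + ((a * v - b * u)\<^sup>2 + (a * w - c * u)\<^sup>2 + (b * w - c * v)\<^sup>2)
      = (a\<^sup>2 + b\<^sup>2 + c\<^sup>2) * (u\<^sup>2 + v\<^sup>2 + w\<^sup>2)"
    by algebra
  with assms show "(a * u + b * v + c * w)\<^sup>2 \<le> a\<^sup>2 + b\<^sup>2 + c\<^sup>2"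
    by (smt (verit) mult_cancel_left2 zero_le_power2 mult_1_right)
qed

text \<open>A quadratic form in \<open>(cos \<alpha>, sin \<alpha>)\<close> with diagonal
  \<open>1, d\<close> and off-diagonal coefficient \<open>k\<close>. It is positive definite because
  \<open>k\<^sup>2 \<le> a\<^sup>2 + b\<^sup>2 < d\<close>.\<close>

lemma trig_form_pos:
  fixes \<alpha> \<psi> a b d :: real
  assumes "a\<^sup>2 + b\<^sup>2 < d"
  shows "0 < (cos \<alpha>)\<^sup>2 + d * (sin \<alpha>)\<^sup>2 + (a * cos \<psi> + b * sin \<psi>) * sin (2 * \<alpha>)"
proof -
  define k where "k = a * cos \<psi> + b * sin \<psi>"
  have "k\<^sup>2 + (a * sin \<psi> - b * cos \<psi>)\<^sup>2 = (a\<^sup>2 + b\<^sup>2) * ((sin \<psi>)\<^sup>2 + (cos \<psi>)\<^sup>2)"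
    unfolding k_def by algebra
  then have "k\<^sup>2 + (a * sin \<psi> - b * cos \<psi>)\<^sup>2 = a\<^sup>2 + b\<^sup>2"
    by simp
  then have "k\<^sup>2 < d"
    using assms zero_le_power2[of "a * sin \<psi> - b * cos \<psi>"] by linarith
  have eq: "(cos \<alpha>)\<^sup>2 + d * (sin \<alpha>)\<^sup>2 + k * sin (2 * \<alpha>)
      = (cos \<alpha> + k * sin \<alpha>)\<^sup>2 + (d - k\<^sup>2) * (sin \<alpha>)\<^sup>2"
    unfolding sin_double by algebra
  show ?thesis
  proof (cases "sin \<alpha> = 0")
    case True
    then show ?thesis
      using sin_cos_squared_add[of \<alpha>] by (simp add: sin_double)
  next
    case False
    with \<open>k\<^sup>2 < d\<close> show ?thesis
      unfolding k_def[symmetric] eq by (intro add_nonneg_pos mult_pos_pos) simp_all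
  qed
qed

lemma N1_pos: "0 < N1 \<alpha> \<psi> c"
proof -
  have q: "0 < 1 + c\<^sup>2"
    by (simp add: add_pos_nonneg)
  have "(1 / (1 + c\<^sup>2))\<^sup>2 + (- c / (1 + c\<^sup>2))\<^sup>2 = 1 / (1 + c\<^sup>2)"
    using q by (simp add: power_divide power2_eq_square[of "1 + c\<^sup>2"] flip: add_divide_distrib)
  also have "\<dots> \<le> 2 / (1 + c\<^sup>2)"
    by (intro divide_right_mono) simp_all
  also have "\<dots> < 1 + 2 / (1 + c\<^sup>2)"
    by simp
  finally have "0 < (cos \<alpha>)\<^sup>2 + (1 + 2 / (1 + c\<^sup>2)) * (sin \<alpha>)\<^sup>2
      + (1 / (1 + c\<^sup>2) * cos \<psi> + - c / (1 + c\<^sup>2) * sin \<psi>) * sin (2 * \<alpha>)"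
    by (rule trig_form_pos)
  also have "\<dots> = N1 \<alpha> \<psi> c"
    unfolding N1_def by (simp add: cos_squared_eq algebra_simps diff_divide_distrib)
  finally show ?thesis .
qed

lemma N2_pos: "0 < N2 \<alpha> \<psi> c"
proof -
  define q where "q = 1 + c\<^sup>2"
  have q: "1 \<le> q" and c: "c\<^sup>2 = q - 1"
    by (auto simp: q_def)
  have "(2 / q\<^sup>2)\<^sup>2 + (- c * (q + 2) / q\<^sup>2)\<^sup>2 = (4 + c\<^sup>2 * (q + 2)\<^sup>2) / (q\<^sup>2)\<^sup>2"
    by (simp only: power_divide power_mult_distrib add_divide_distrib power2_minus) simp
  also have "4 + c\<^sup>2 * (q + 2)\<^sup>2 = (q + 3) * q\<^sup>2"
    unfolding c by algebra
  also have "(q + 3) * q\<^sup>2 / (q\<^sup>2)\<^sup>2 = (q + 3) / q\<^sup>2"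
    using q by (simp add: power2_eq_square field_simps)
  also have "\<dots> \<le> 2 * (q + 2) / q\<^sup>2"
    using q by (intro divide_right_mono) simp_all
  also have "\<dots> < 1 + 2 * (q + 2) / q\<^sup>2"
    by simp
  finally have "0 < (cos \<alpha>)\<^sup>2 + (1 + 2 * (q + 2) / q\<^sup>2) * (sin \<alpha>)\<^sup>2
      + (2 / q\<^sup>2 * cos \<psi> + - c * (q + 2) / q\<^sup>2 * sin \<psi>) * sin (2 * \<alpha>)"
    by (rule trig_form_pos)
  also have "\<dots> = N2 \<alpha> \<psi> c"
    unfolding N2_def q_def by (simp add: cos_squared_eq algebra_simps diff_divide_distrib add_divide_distrib)
  finally show ?thesis .
qed

text \<open>The lower bound of the duality: at the optimal \<open>l\<close>, the concave function
  \<open>2 * l * N1 - l\<^sup>2 * N2\<close> takes the value \<open>N1\<^sup>2 / N2\<close>, and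
  Cauchy-Schwarz bounds it by four times the score.\<close>

lemma asymp_ratio_ge_score:
  obtains q x where "1 \<le> q" "0 < q + 2 + x" "0 < score q x"
    "1 / score q x - 3 \<le> asymp_ratio \<alpha> \<psi> c"
proof -
  define n\<^sub>1 n\<^sub>2 where "n\<^sub>1 = N1 \<alpha> \<psi> c" and "n\<^sub>2 = N2 \<alpha> \<psi> c"
  have pos: "0 < n\<^sub>1" "0 < n\<^sub>2"
    by (simp_all add: n\<^sub>1_def n\<^sub>2_def N1_pos N2_pos)
  define q where "q = 1 + c\<^sup>2"
  \<comment> \<open>Chosen such that \<open>l = 2 * q / (q + 2 + x)\<close> is the maximizer
    \<open>n\<^sub>1 / n\<^sub>2\<close>.\<close>
  define x where "x = 2 * q * n\<^sub>2 / n\<^sub>1 - q - 2"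
  have q: "1 \<le> q"
    by (simp add: q_def)
  have L: "q + 2 + x = 2 * q * n\<^sub>2 / n\<^sub>1"
    by (simp add: x_def)
  have "(sin (2 * \<alpha>) * cos \<psi>)\<^sup>2 + (sin (2 * \<alpha>) * sin \<psi>)\<^sup>2 + (cos (2 * \<alpha>))\<^sup>2
      = (sin (2 * \<alpha>))\<^sup>2 * ((sin \<psi>)\<^sup>2 + (cos \<psi>)\<^sup>2) + (cos (2 * \<alpha>))\<^sup>2"
    by algebra
  then have "(sin (2 * \<alpha>) * cos \<psi>)\<^sup>2 + (sin (2 * \<alpha>) * sin \<psi>)\<^sup>2 + (cos (2 * \<alpha>))\<^sup>2 = 1"
    by simp
  from dot_le_sqrt_3[OF this, of "q + x" "- c * x" "- x"]
  have "(q + x) * (sin (2 * \<alpha>) * cos \<psi>) - c * x * (sin (2 * \<alpha>) * sin \<psi>) - x * cos (2 * \<alpha>)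
      \<le> sqrt ((q + x)\<^sup>2 + q * x\<^sup>2)"
    by (simp add: q_def power_mult_distrib algebra_simps)
  then have "(q + 2 + x) * q * n\<^sub>1 - q\<^sup>2 * n\<^sub>2 \<le> (q + 1) * x + 2 * q + sqrt ((q + x)\<^sup>2 + q * x\<^sup>2)"
    using N1_N2_combination[of c x \<alpha> \<psi>] unfolding q_def n\<^sub>1_def n\<^sub>2_def by linarith
  moreover have "(q + 2 + x) * q * n\<^sub>1 - q\<^sup>2 * n\<^sub>2 = q\<^sup>2 * n\<^sub>2"
    unfolding L using pos by (simp add: power2_eq_square)
  ultimately have "q\<^sup>2 * n\<^sub>2 / (q + 2 + x)\<^sup>2 \<le> score q x"
    unfolding score_def by (intro divide_right_mono) simp_all
  also have "q\<^sup>2 * n\<^sub>2 / (q + 2 + x)\<^sup>2 = n\<^sub>1\<^sup>2 / (4 * n\<^sub>2)"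
    unfolding L using pos q by (simp add: field_simps power2_eq_square)
  finally have score: "n\<^sub>1\<^sup>2 / (4 * n\<^sub>2) \<le> score q x" .
  moreover have "0 < n\<^sub>1\<^sup>2 / (4 * n\<^sub>2)"
    using pos by simp
  ultimately have "1 / score q x \<le> 1 / (n\<^sub>1\<^sup>2 / (4 * n\<^sub>2))"
    by (intro divide_left_mono mult_pos_pos) linarith+
  then have "1 / score q x - 3 \<le> asymp_ratio \<alpha> \<psi> c"
    by (simp add: asymp_ratio_def n\<^sub>1_def n\<^sub>2_def)
  moreover have "0 < q + 2 + x"
    unfolding L using pos q by simp
  ultimately show thesis
    using that q score \<open>0 < n\<^sub>1\<^sup>2 / (4 * n\<^sub>2)\<close> by force
qed

text \<open>Equality in the Cauchy-Schwarz inequality: the Bloch vector of the state points along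
  \<open>(q + x, - c x, - x)\<close>.\<close>

lemma asymp_ratio_le_score:
  fixes c x :: real
  defines "q \<equiv> 1 + c\<^sup>2" and "\<rho> \<equiv> sqrt ((1 + c\<^sup>2 + x)\<^sup>2 + c\<^sup>2 * x\<^sup>2)"
  defines "\<psi> \<equiv> arctan (- c * x / (q + x))" and "\<alpha> \<equiv> pi / 4 + arctan (x / \<rho>) / 2"
  assumes "0 < x"
  shows "asymp_ratio \<alpha> \<psi> c \<le> 1 / score q x - 3"
proof -
  define r where "r = sqrt ((q + x)\<^sup>2 + q * x\<^sup>2)"
  have q: "1 \<le> q"
    by (simp add: q_def)
  have \<rho>2: "\<rho>\<^sup>2 = (q + x)\<^sup>2 + c\<^sup>2 * x\<^sup>2"
    by (simp add: \<rho>_def q_def)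
  have \<rho>: "0 < \<rho>"
    using q \<open>0 < x\<close> unfolding \<rho>_def q_def real_sqrt_gt_0_iff
    by (intro add_pos_nonneg zero_less_power) simp_all
  have r2: "r\<^sup>2 = (q + x)\<^sup>2 + q * x\<^sup>2"
    using q by (simp add: r_def)
  have r: "0 < r"
    using q \<open>0 < x\<close> unfolding r_def by (auto intro!: add_pos_nonneg)
  have "sqrt (1 + (- c * x / (q + x))\<^sup>2) = \<rho> / (q + x)"
  proof (rule real_sqrt_unique)
    show "(\<rho> / (q + x))\<^sup>2 = 1 + (- c * x / (q + x))\<^sup>2"
      using q \<open>0 < x\<close> by (simp add: power_divide \<rho>2 field_simps)
  qed (use q \<open>0 < x\<close> \<rho> in simp)
  then have \<psi>: "cos \<psi> = (q + x) / \<rho>" "sin \<psi> = - c * x / \<rho>"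
    using q \<open>0 < x\<close> unfolding \<psi>_def cos_arctan sin_arctan by simp_all
  have "sqrt (1 + (x / \<rho>)\<^sup>2) = r / \<rho>"
  proof (rule real_sqrt_unique)
    have "r\<^sup>2 = \<rho>\<^sup>2 + x\<^sup>2"
      unfolding r2 \<rho>2 by (simp add: q_def algebra_simps)
    then show "(r / \<rho>)\<^sup>2 = 1 + (x / \<rho>)\<^sup>2"
      using \<rho> by (simp add: power_divide field_simps)
  qed (use r \<rho> in simp)
  \<comment> \<open>The quarter turn swaps sine and cosine and makes
    \<open>cos (2 * \<alpha>)\<close> negative, as the direction
    \<open>(q + x, - c * x, - x)\<close> requires.\<close>
  moreover have "2 * \<alpha> = pi / 2 + arctan (x / \<rho>)"
    by (simp add: \<alpha>_def)
  ultimately have \<alpha>: "sin (2 * \<alpha>) = \<rho> / r" "cos (2 * \<alpha>) = - x / r"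
    using \<rho> by (simp_all add: sin_add cos_add cos_arctan sin_arctan)
  define n\<^sub>1 n\<^sub>2 L where "n\<^sub>1 = N1 \<alpha> \<psi> c" and "n\<^sub>2 = N2 \<alpha> \<psi> c" and "L = q + 2 + x"
  have pos: "0 < n\<^sub>1" "0 < n\<^sub>2" "0 < L"
    using q \<open>0 < x\<close> by (simp_all add: n\<^sub>1_def n\<^sub>2_def L_def N1_pos N2_pos)
  have "(q + x) * (sin (2 * \<alpha>) * cos \<psi>) - c * x * (sin (2 * \<alpha>) * sin \<psi>) - x * cos (2 * \<alpha>)
      = ((q + x)\<^sup>2 + q * x\<^sup>2) / r"
    unfolding \<alpha> \<psi> using r \<rho> by (simp add: q_def field_simps power2_eq_square)
  also have "\<dots> = r"
    unfolding r2[symmetric] using r by (simp add: power2_eq_square)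
  finally have "L * q * n\<^sub>1 - q\<^sup>2 * n\<^sub>2 = (q + 1) * x + 2 * q + r"
    using N1_N2_combination[of c x \<alpha> \<psi>] unfolding q_def n\<^sub>1_def n\<^sub>2_def L_def by linarith
  then have score: "score q x = (L * q * n\<^sub>1 - q\<^sup>2 * n\<^sub>2) / L\<^sup>2"
    by (simp add: score_def r_def L_def)
  have "0 < score q x"
    unfolding score_def using q \<open>0 < x\<close> by (auto intro!: divide_pos_pos add_pos_nonneg)
  \<comment> \<open>This square says that \<open>2 * l * n\<^sub>1 - l\<^sup>2 * n\<^sub>2\<close>
    at \<open>l = 2 * q / L\<close> stays below its maximum over \<open>l\<close>.\<close>
  have "0 \<le> (L * n\<^sub>1 - 2 * q * n\<^sub>2)\<^sup>2"
    by simp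
  then have "(L * q * n\<^sub>1 - q\<^sup>2 * n\<^sub>2) * (4 * n\<^sub>2) \<le> n\<^sub>1\<^sup>2 * L\<^sup>2"
    by (simp add: power2_eq_square algebra_simps)
  then have "score q x \<le> n\<^sub>1\<^sup>2 / (4 * n\<^sub>2)"
    using pos unfolding score by (simp add: field_simps)
  then have "1 / (n\<^sub>1\<^sup>2 / (4 * n\<^sub>2)) \<le> 1 / score q x"
    using pos \<open>0 < score q x\<close> by (intro divide_left_mono mult_pos_pos) simp_all
  then show ?thesis
    by (simp add: asymp_ratio_def n\<^sub>1_def n\<^sub>2_def)
qed

section \<open>Decimal enclosures of the minimizer\<close>

text \<open>The arguments bracket the tangents of \<psi> and of \<open>2 * \<alpha> - pi / 2\<close>
  at the minimizer. In degrees the targets are 23.87 and 2 * 55.67 - 90 = 21.34; doubling the angle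
  doubles the tolerance.\<close>

lemma arctan_enclosures:
  "23.865 * pi / 180 < arctan 0.4425" "arctan 0.4426 < 23.875 * pi / 180"
  "21.33 * pi / 180 < arctan 0.3906" "arctan 0.3907 < 21.35 * pi / 180"
  using arctan_lower_bound[of "0.4425" 4] arctan_upper_bound[of "0.4426" 4]
    arctan_lower_bound[of "0.3906" 4] arctan_upper_bound[of "0.3907" 4] pi_approx
  by (simp_all add: eval_nat_numeral)

text \<open>Interval propagation from \<open>(q, x)\<close> to the parameters of the state and the
  phase, where \<open>q - 1\<close> stands for \<open>c\<^sup>2\<close>.\<close>

lemma optimal_parameters_located:
  fixes q x :: real
  assumes "\<bar>q - q\<^sub>0\<bar> \<le> 2 / 10^6" and "\<bar>x - x\<^sub>0\<bar> \<le> 2 / 10^6"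
  defines "\<rho> \<equiv> sqrt ((q + x)\<^sup>2 + (q - 1) * x\<^sup>2)"
  shows "1.03593 < sqrt (q - 1)" "sqrt (q - 1) < 1.03594"
    "23.865 * pi / 180 < arctan (sqrt (q - 1) * x / (q + x))"
    "arctan (sqrt (q - 1) * x / (q + x)) < 23.875 * pi / 180"
    "21.33 * pi / 180 < arctan (x / \<rho>)" "arctan (x / \<rho>) < 21.35 * pi / 180"
proof -
  have q: "2.073155 \<le> q" "q \<le> 2.07316" and x: "1.546213 \<le> x" "x \<le> 1.54622"
    using assms(1,2) unfolding abs_le_iff q\<^sub>0_def x\<^sub>0_def by simp_all
  show c: "1.03593 < sqrt (q - 1)" "sqrt (q - 1) < 1.03594"
    using q by (intro real_less_rsqrt real_less_lsqrt; simp add: power2_eq_square)+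
  have "1.03593 * 1.546213 \<le> sqrt (q - 1) * x" "sqrt (q - 1) * x \<le> 1.03594 * 1.54622"
    using c q x by (intro mult_mono; simp)+
  then have "0.4425 < sqrt (q - 1) * x / (q + x)" "sqrt (q - 1) * x / (q + x) < 0.4426"
    using q x by (simp_all add: field_simps)
  then show "23.865 * pi / 180 < arctan (sqrt (q - 1) * x / (q + x))"
    "arctan (sqrt (q - 1) * x / (q + x)) < 23.875 * pi / 180"
    using arctan_enclosures arctan_less_iff less_trans by blast+
  have sq: "3.619368\<^sup>2 \<le> (q + x)\<^sup>2" "(q + x)\<^sup>2 \<le> 3.61938\<^sup>2" "1.546213\<^sup>2 \<le> x\<^sup>2" "x\<^sup>2 \<le> 1.54622\<^sup>2"
    using q x by (intro power_mono; simp)+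
  have "1.073155 * 1.546213\<^sup>2 \<le> (q - 1) * x\<^sup>2" "(q - 1) * x\<^sup>2 \<le> 1.07316 * 1.54622\<^sup>2"
    using sq q by (intro mult_mono; simp)+
  then have "3.9579\<^sup>2 < (q + x)\<^sup>2 + (q - 1) * x\<^sup>2" "(q + x)\<^sup>2 + (q - 1) * x\<^sup>2 < 3.958\<^sup>2"
    using sq by (simp_all add: power2_eq_square[of "numeral _ / _"])
  then have "3.9579 < \<rho>" "\<rho> < 3.958"
    unfolding \<rho>_def by (intro real_less_rsqrt real_less_lsqrt; simp)+
  then have "0.3906 < x / \<rho>" "x / \<rho> < 0.3907"
    using x by (simp_all add: field_simps)
  then show "21.33 * pi / 180 < arctan (x / \<rho>)" "arctan (x / \<rho>) < 21.35 * pi / 180"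
    using arctan_enclosures arctan_less_iff less_trans by blast+
qed

text \<open>Both bounds meet at the maximal score, so the parameters built from its maximizer attain
  the minimum. Each tolerance is half a unit of the last displayed digit.\<close>

lemma asymp_ratio_minimum:
  "\<exists>\<alpha> \<psi> c. (\<forall>\<alpha>' \<psi>' c'. asymp_ratio \<alpha> \<psi> c \<le> asymp_ratio \<alpha>' \<psi>' c') \<and>
        \<bar>asymp_ratio \<alpha> \<psi> c - (-0.5982)\<bar> < 0.00005 \<and>
        \<bar>\<alpha> * 180 / pi - 55.67\<bar> < 0.005 \<and>
        \<bar>\<psi> * 180 / pi - 23.87\<bar> < 0.005 \<and>
        \<bar>c - (-1.0359)\<bar> < 0.00005"
proof -
  obtain q x where q: "1 \<le> q" and L: "0 < q + 2 + x" and h: "h\<^sub>0 \<le> score q x"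
    and max: "\<And>q' x'. 1 \<le> q' \<Longrightarrow> 0 < q' + 2 + x' \<Longrightarrow> score q' x' \<le> score q x"
    using score_attains_max by blast
  note near = near_optimum[OF q L h]
  note loc = optimal_parameters_located[OF near]
  have x: "1.5 < x"
    using near(2) unfolding abs_le_iff x\<^sub>0_def by simp
  \<comment> \<open>The ratio is invariant under changing the signs of both \<psi> and
    \<open>c\<close>; the negative root selects the minimizer with positive \<psi>.\<close>
  define c where "c = - sqrt (q - 1)"
  define \<psi> where "\<psi> = arctan (- c * x / (q + x))"
  define \<rho> where "\<rho> = sqrt ((q + x)\<^sup>2 + (q - 1) * x\<^sup>2)"
  define \<alpha> where "\<alpha> = pi / 4 + arctan (x / \<rho>) / 2"
  have c2: "c\<^sup>2 = q - 1"
    using q by (simp add: c_def)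
  have le: "asymp_ratio \<alpha> \<psi> c \<le> 1 / score q x - 3"
    using asymp_ratio_le_score[of x c] x by (simp add: c2 \<alpha>_def \<psi>_def \<rho>_def)
  have ge: "1 / score q x - 3 \<le> asymp_ratio \<alpha>' \<psi>' c'" for \<alpha>' \<psi>' c'
  proof -
    obtain q' x' where *: "1 \<le> q'" "0 < q' + 2 + x'" "0 < score q' x'"
      "1 / score q' x' - 3 \<le> asymp_ratio \<alpha>' \<psi>' c'"
      using asymp_ratio_ge_score by blast
    have "1 / score q x \<le> 1 / score q' x'"
      using max[OF *(1,2)] *(3) by (intro divide_left_mono mult_pos_pos) linarith+
    with * show ?thesis by linarith
  qed
  have "1 \<le> (q + 2 + x)\<^sup>2"
    using q x by (intro one_le_power) simp
  then have "1 / 10^6 / (q + 2 + x)\<^sup>2 \<le> (1 / 10^6 :: real)"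
    by (simp add: divide_le_eq)
  with score_le[OF q L] have h': "score q x \<le> h\<^sub>0 + 1 / 10^6"
    by linarith
  have "1 / score q x \<le> 1 / h\<^sub>0"
    using h by (intro divide_left_mono mult_pos_pos) (auto simp: h\<^sub>0_def)
  moreover have "1 / (h\<^sub>0 + 1 / 10^6) \<le> 1 / score q x"
    using h h' by (intro divide_left_mono mult_pos_pos) (auto simp: h\<^sub>0_def)
  \<comment> \<open>After subtracting 3 these bounds deviate from -0.5982 by 0.00004, within the
    tolerance.\<close>
  moreover have "1 / h\<^sub>0 < 2.40184" "2.40176 < 1 / (h\<^sub>0 + 1 / 10^6)"
    by (simp_all add: h\<^sub>0_def)
  ultimately have "2.40176 < 1 / score q x" "1 / score q x < 2.40184"
    by linarith+
  moreover have "asymp_ratio \<alpha> \<psi> c = 1 / score q x - 3"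
    using le ge[of \<alpha> \<psi> c] by linarith
  ultimately have val: "\<bar>asymp_ratio \<alpha> \<psi> c - (-0.5982)\<bar> < 0.00005"
    unfolding abs_less_iff by simp
  have "- c * x / (q + x) = sqrt (q - 1) * x / (q + x)"
    by (simp add: c_def)
  then have "23.865 * pi / 180 < \<psi>" "\<psi> < 23.875 * pi / 180"
    using loc(3,4) by (simp_all add: \<psi>_def)
  then have \<psi>: "\<bar>\<psi> * 180 / pi - 23.87\<bar> < 0.005"
    unfolding abs_less_iff by (simp add: field_simps)
  have \<alpha>: "\<bar>\<alpha> * 180 / pi - 55.67\<bar> < 0.005"
    using loc(5,6) unfolding \<alpha>_def \<rho>_def abs_less_iff by (simp add: field_simps)
  have "\<bar>c - (-1.0359)\<bar> < 0.00005"
    using loc(1,2) unfolding c_def abs_less_iff by simp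
  moreover have "asymp_ratio \<alpha> \<psi> c \<le> asymp_ratio \<alpha>' \<psi>' c'" for \<alpha>' \<psi>' c'
    using le ge[of \<alpha>' \<psi>' c'] by linarith
  ultimately show ?thesis
    using val \<psi> \<alpha> by blast
qed

theorem mainTheorem2:
  shows
    "(\<forall>(\<alpha>::real) (\<psi>::real) (c::real).
        (\<forall>\<gamma>\<in>{0<..<pi/2}.
           (\<exists>!X. solves_stein (no_tick \<psi> c \<gamma>) (init_state \<alpha>) X) \<and>
           (\<exists>!X. solves_stein (no_tick \<psi> c \<gamma>) (X1 \<alpha> \<psi> c \<gamma>) X) \<and>
           trace (X1 \<alpha> \<psi> c \<gamma>) \<in> \<real> \<and> trace (X2 \<alpha> \<psi> c \<gamma>) \<in> \<real>) \<and>
        (\<lambda>\<gamma>. trace (X1 \<alpha> \<psi> c \<gamma>)) \<sim>[at_right 0] (\<lambda>\<gamma>. of_real (N1 \<alpha> \<psi> c / \<gamma>^2)) \<and>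
        (\<lambda>\<gamma>. trace (X2 \<alpha> \<psi> c \<gamma>)) \<sim>[at_right 0] (\<lambda>\<gamma>. of_real (N2 \<alpha> \<psi> c / \<gamma>^4)) \<and>
        filterlim (tick_mean \<alpha> \<psi> c) at_top (at_right 0) \<and>
        ((\<lambda>\<gamma>. CF2 \<alpha> \<psi> c \<gamma> / (tick_mean \<alpha> \<psi> c \<gamma>)^2)
           \<longlongrightarrow> asymp_ratio \<alpha> \<psi> c) (at_right 0)) \<and>
     (\<exists>(\<alpha>::real) (\<psi>::real) (c::real).
        (\<forall>\<alpha>' \<psi>' c'. asymp_ratio \<alpha> \<psi> c \<le> asymp_ratio \<alpha>' \<psi>' c') \<and>
        \<bar>asymp_ratio \<alpha> \<psi> c - (-0.5982)\<bar> < 0.00005 \<and>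
        \<bar>\<alpha> * 180 / pi - 55.67\<bar> < 0.005 \<and>
        \<bar>\<psi> * 180 / pi - 23.87\<bar> < 0.005 \<and>
        \<bar>c - (-1.0359)\<bar> < 0.00005)"
proof (intro conjI allI ballI asymp_ratio_minimum)
  fix \<alpha> \<psi> c :: real
  show "\<exists>!X. solves_stein (no_tick \<psi> c \<gamma>) (init_state \<alpha>) X"
    "\<exists>!X. solves_stein (no_tick \<psi> c \<gamma>) (X1 \<alpha> \<psi> c \<gamma>) X"
    "trace (X1 \<alpha> \<psi> c \<gamma>) \<in> \<real>" "trace (X2 \<alpha> \<psi> c \<gamma>) \<in> \<real>"
    if "\<gamma> \<in> {0<..<pi/2}" for \<gamma>
  proof -
    from that have \<gamma>: "0 < \<gamma>" "\<gamma> < pi / 2"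
      by simp_all
    show "\<exists>!X. solves_stein (no_tick \<psi> c \<gamma>) (init_state \<alpha>) X"
      "\<exists>!X. solves_stein (no_tick \<psi> c \<gamma>) (X1 \<alpha> \<psi> c \<gamma>) X"
      by (rule ex1_solves_stein_no_tick[OF \<gamma>])+
    show "trace (X1 \<alpha> \<psi> c \<gamma>) \<in> \<real>" "trace (X2 \<alpha> \<psi> c \<gamma>) \<in> \<real>"
      by (rule trace_X1_real[OF \<gamma>] trace_X2_real[OF \<gamma>])+
  qed
  show "(\<lambda>\<gamma>. trace (X1 \<alpha> \<psi> c \<gamma>)) \<sim>[at_right 0] (\<lambda>\<gamma>. of_real (N1 \<alpha> \<psi> c / \<gamma>^2))"
    using scaled_traces_tendsto(1) N1_pos[THEN less_imp_neq, symmetric]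
    by (rule asymp_equiv_of_scaled_limit)
  show "(\<lambda>\<gamma>. trace (X2 \<alpha> \<psi> c \<gamma>)) \<sim>[at_right 0] (\<lambda>\<gamma>. of_real (N2 \<alpha> \<psi> c / \<gamma>^4))"
    using scaled_traces_tendsto(2) N2_pos[THEN less_imp_neq, symmetric]
    by (rule asymp_equiv_of_scaled_limit)
  show "filterlim (tick_mean \<alpha> \<psi> c) at_top (at_right 0)"
    "((\<lambda>\<gamma>. CF2 \<alpha> \<psi> c \<gamma> / (tick_mean \<alpha> \<psi> c \<gamma>)^2) \<longlongrightarrow> asymp_ratio \<alpha> \<psi> c) (at_right 0)"
    by (intro tick_mean_at_top CF2_ratio_tendsto N1_pos)+
qed

end
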